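(* Let $X$ and $Y$ be $T_0$ spaces, and let $\mathbb{C}(X,Y)$ be the set of all continuous functions from $X$ to $Y$. Then the following two conditions are equivalent: (1) $Y$ is a $d$-space. (2) $\mathbb{C}(X,Y)$ equipped with the compact-open topology is a $d$-space.
   Context: The specialization order of a $T_0$ space $X$ is $x\leq y$ iff $x\in\overline{\{y\}}$. A $T_0$ space $X$ is a $d$-space if $X$ with the specialization order is a dcpo (every directed subset has a supremum; directed sets are nonempty) and every open set of $X$ is Scott open in this order (an upper set $U$ such that every directed set whose supremum lies in $U$ meets $U$); equivalently, for every directed $D\subseteq X$ there is a point $x$ with $\overline{D}=\overline{\{x\}}$. The compact-open topology on $\mathbb{C}(X,Y)$ is generated (as a subbasis) by the sets $N(K\rightarrow V)=\{f\in\mathbb{C}(X,Y): f(K)\subseteq V\}$, with $K$ compact in $X$ and $V$ open in $Y$ (no Hausdorff assumption).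
   Formalization: The space X is assumed nonempty; for empty X, the set of continuous functions from X to Y is a single point, hence a d-space for every Y, so (2) would not imply (1). *)

theory Defs
  imports "HOL-Analysis.Analysis"
begin

text \<open>
  Spaces are values of type \<open>'a topology\<close>, with carrier \<open>topspace X\<close>.  The order notions below are
  those of the specialization order on that carrier.
\<close>

text \<open>Both arguments are automatically points of \<open>X\<close>: \<open>X closure_of {y}\<close> is a subset of
  \<open>topspace X\<close>, and it is empty when \<open>y\<close> lies outside \<open>topspace X\<close>.\<close>

definition specialization_le :: "'a topology \<Rightarrow> 'a \<Rightarrow> 'a \<Rightarrow> bool" where
  "specialization_le X x y \<longleftrightarrow> x \<in> X closure_of {y}"

definition directedin :: "'a topology \<Rightarrow> 'a set \<Rightarrow> bool" where
  "directedin X D \<longleftrightarrow> D \<noteq> {} \<and> D \<subseteq> topspace X \<and>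
     (\<forall>x\<in>D. \<forall>y\<in>D. \<exists>z\<in>D. specialization_le X x z \<and> specialization_le X y z)"

definition is_supremum_in :: "'a topology \<Rightarrow> 'a set \<Rightarrow> 'a \<Rightarrow> bool" where
  "is_supremum_in X D s \<longleftrightarrow> s \<in> topspace X \<and> (\<forall>x\<in>D. specialization_le X x s) \<and>
     (\<forall>u\<in>topspace X. (\<forall>x\<in>D. specialization_le X x u) \<longrightarrow> specialization_le X s u)"

definition dcpo_space :: "'a topology \<Rightarrow> bool" where
  "dcpo_space X \<longleftrightarrow> (\<forall>D. directedin X D \<longrightarrow> (\<exists>s. is_supremum_in X D s))"

definition scott_openin :: "'a topology \<Rightarrow> 'a set \<Rightarrow> bool" where
  "scott_openin X U \<longleftrightarrow> U \<subseteq> topspace X \<and>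
     (\<forall>x y. x \<in> U \<and> specialization_le X x y \<longrightarrow> y \<in> U) \<and>
     (\<forall>D s. directedin X D \<and> is_supremum_in X D s \<and> s \<in> U \<longrightarrow> D \<inter> U \<noteq> {})"

definition d_space :: "'a topology \<Rightarrow> bool" where
  "d_space X \<longleftrightarrow> t0_space X \<and> dcpo_space X \<and> (\<forall>U. openin X U \<longrightarrow> scott_openin X U)"

text \<open>HOL functions are total, so a map \<open>X \<rightarrow> Y\<close> is represented by the unique function with
  the prescribed values on \<open>topspace X\<close> that is \<open>undefined\<close> elsewhere.\<close>

definition continuous_maps :: "'a topology \<Rightarrow> 'b topology \<Rightarrow> ('a \<Rightarrow> 'b) set" where
  "continuous_maps X Y = {f. continuous_map X Y f \<and> f \<in> extensional (topspace X)}"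

definition compact_open_subbasic ::
    "'a topology \<Rightarrow> 'b topology \<Rightarrow> 'a set \<Rightarrow> 'b set \<Rightarrow> ('a \<Rightarrow> 'b) set" where
  "compact_open_subbasic X Y K V = {f \<in> continuous_maps X Y. f ` K \<subseteq> V}"

definition compact_open_topology :: "'a topology \<Rightarrow> 'b topology \<Rightarrow> ('a \<Rightarrow> 'b) topology" where
  "compact_open_topology X Y =
     topology_generated_by {compact_open_subbasic X Y K V | K V. compactin X K \<and> openin Y V}"

lemma topspace_compact_open_topology [simp]:
  "topspace (compact_open_topology X Y) = continuous_maps X Y"
proof -
  have "compactin X {}" "openin Y {}"
    by auto
  moreover have "compact_open_subbasic X Y {} {} = continuous_maps X Y"
    by (simp add: compact_open_subbasic_def)
  ultimately have "continuous_maps X Y \<in>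
      {compact_open_subbasic X Y K V | K V. compactin X K \<and> openin Y V}"
    by blast
  then show ?thesis
    unfolding compact_open_topology_def topology_generated_by_topspace
    by (auto simp: compact_open_subbasic_def)
qed

end

theory Submission
  imports Defs
begin

text \<open>
  A \<open>T\<^sub>0\<close> space is a \<open>d\<close>-space iff every directed set \<open>D\<close> has a directed limit: an upper bound all
  of whose open neighbourhoods meet \<open>D\<close>.  The specialization order of the compact-open topology
  is pointwise, since singletons are compact.  If \<open>Y\<close> is a \<open>d\<close>-space and \<open>F\<close> is a directed set of
  maps, the pointwise directed limits form a continuous map \<open>s\<close>; it is a directed limit of \<open>F\<close>
  because \<open>s ` K \<subseteq> V\<close> says that the directed family of preimages of \<open>V\<close> under members of \<open>F\<close>
  covers the compact set \<open>K\<close>, so a single one of them contains \<open>K\<close>.  Conversely, embed \<open>Y\<close> in the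
  function space as constant maps and evaluate a directed limit at a point.
\<close>

section \<open>Specialization order and directed limits\<close>

lemma specialization_le_iff:
  "specialization_le X x y \<longleftrightarrow> x \<in> topspace X \<and> (\<forall>U. openin X U \<and> x \<in> U \<longrightarrow> y \<in> U)"
  unfolding specialization_le_def in_closure_of by auto

lemma specialization_leD:
  "\<lbrakk>specialization_le X x y; openin X U; x \<in> U\<rbrakk> \<Longrightarrow> y \<in> U"
  by (simp add: specialization_le_iff)

lemma specialization_le_trans:
  "\<lbrakk>specialization_le X x y; specialization_le X y z\<rbrakk> \<Longrightarrow> specialization_le X x z"
  by (auto simp: specialization_le_iff)

text \<open>The order clause puts \<open>D\<close> inside the closure of \<open>{s}\<close>, and the
  last clause puts \<open>s\<close> in the closure of \<open>D\<close>; together they say that these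
  two closures coincide.\<close>

definition directed_limit :: "'a topology \<Rightarrow> 'a set \<Rightarrow> 'a \<Rightarrow> bool" where
  "directed_limit X D s \<longleftrightarrow> s \<in> topspace X \<and> (\<forall>x\<in>D. specialization_le X x s) \<and>
     (\<forall>U. openin X U \<and> s \<in> U \<longrightarrow> D \<inter> U \<noteq> {})"

text \<open>An open neighbourhood of \<open>s\<close> meets \<open>D\<close> in some
  \<open>x\<close>; any upper bound \<open>u\<close> of \<open>D\<close> lies above \<open>x\<close>
  and hence in that neighbourhood.\<close>

lemma directed_limit_imp_supremum:
  assumes "directed_limit X D s"
  shows "is_supremum_in X D s"
  using assms unfolding directed_limit_def is_supremum_in_def
  by (auto simp: specialization_le_iff)

lemma d_space_iff_directed_limit:
  "d_space X \<longleftrightarrow> t0_space X \<and> (\<forall>D. directedin X D \<longrightarrow> (\<exists>s. directed_limit X D s))"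
proof (intro iffI conjI allI impI)
  fix D
  assume d: "d_space X" and D: "directedin X D"
  then obtain s where "is_supremum_in X D s"
    unfolding d_space_def dcpo_space_def by blast
  with d D have "directed_limit X D s"
    unfolding d_space_def scott_openin_def directed_limit_def is_supremum_in_def by blast
  then show "\<exists>s. directed_limit X D s" ..
next
  assume *: "t0_space X \<and> (\<forall>D. directedin X D \<longrightarrow> (\<exists>s. directed_limit X D s))"
  \<comment> \<open>The given supremum \<open>s\<close> need not be known to be a directed limit,
    but it lies below the limit \<open>t\<close>, so \<open>t\<close> is in \<open>U\<close> too and
    \<open>U\<close> meets \<open>D\<close>.\<close>
  have "D \<inter> U \<noteq> {}"
    if U: "openin X U" and D: "directedin X D" and s: "is_supremum_in X D s" "s \<in> U" for U D s
  proof -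
    obtain t where t: "directed_limit X D t"
      using * D by blast
    then have "specialization_le X s t"
      using s unfolding is_supremum_in_def directed_limit_def by blast
    then show ?thesis
      using t U s(2) unfolding directed_limit_def by (blast dest: specialization_leD)
  qed
  then show "d_space X"
    using * unfolding d_space_def dcpo_space_def scott_openin_def
    by (blast dest: directed_limit_imp_supremum specialization_leD openin_subset)
qed (simp add: d_space_def)

lemma directedin_finite_upper_bound:
  assumes "directedin X D" and "finite A" and "A \<subseteq> D"
  shows "\<exists>u\<in>D. \<forall>a\<in>A. specialization_le X a u"
  using assms(2,3)
proof (induction A)
  case empty
  then show ?case
    using assms(1) by (auto simp: directedin_def)
next
  case (insert a A)
  then obtain u where "u \<in> D" "\<forall>a\<in>A. specialization_le X a u"
    by auto
  moreover obtain v where "v \<in> D" "specialization_le X a v" "specialization_le X u v"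
    using assms(1) insert.prems \<open>u \<in> D\<close> unfolding directedin_def by blast
  ultimately show ?case
    by (blast intro: specialization_le_trans)
qed

section \<open>Specialization order and separation in the function space\<close>

lemma openin_compact_open_subbasic:
  "\<lbrakk>compactin X K; openin Y V\<rbrakk>
    \<Longrightarrow> openin (compact_open_topology X Y) (compact_open_subbasic X Y K V)"
  unfolding compact_open_topology_def by (blast intro: topology_generated_by_Basis)

text \<open>Forwards, test with the subbasic sets of the compact sets \<open>{x}\<close>. Backwards,
  subbasic sets are closed under pointwise increase because open sets of \<open>Y\<close> are upper
  sets, and intersections and unions preserve this.\<close>

lemma specialization_le_compact_open:
  "specialization_le (compact_open_topology X Y) f g \<longleftrightarrow>
     f \<in> continuous_maps X Y \<and> g \<in> continuous_maps X Y \<and>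
     (\<forall>x\<in>topspace X. specialization_le Y (f x) (g x))"
  (is "?L \<longleftrightarrow> ?R")
proof
  assume L: ?L
  then have f: "f \<in> continuous_maps X Y"
    by (simp add: specialization_le_iff)
  moreover have "g \<in> continuous_maps X Y"
    using specialization_leD[OF L openin_topspace] f by simp
  moreover have "specialization_le Y (f x) (g x)" if x: "x \<in> topspace X" for x
    unfolding specialization_le_iff
  proof (intro conjI allI impI)
    show "f x \<in> topspace Y"
      using f x by (auto simp: continuous_maps_def continuous_map_def)
  next
    fix V assume "openin Y V \<and> f x \<in> V"
    then show "g x \<in> V"
      using specialization_leD[OF L openin_compact_open_subbasic[of X "{x}" Y V]] f x
      by (auto simp: compact_open_subbasic_def)
  qed
  ultimately show ?R by blast
next
  assume R: ?R
  have "f \<in> U \<longrightarrow> g \<in> U" if "openin (compact_open_topology X Y) U" for U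
    using that[unfolded compact_open_topology_def openin_topology_generated_by_iff]
  proof induction
    case (Basis S)
    then obtain K V where S: "S = compact_open_subbasic X Y K V" "K \<subseteq> topspace X" "openin Y V"
      by (auto dest: compactin_subset_topspace)
    then show ?case
      using R unfolding compact_open_subbasic_def
      by (auto dest!: specialization_leD[OF _ S(3)] subsetD)
  qed blast+
  then show ?L
    using R by (simp add: specialization_le_iff)
qed

text \<open>Distinct extensional maps differ at a point of the carrier, and an open set separating
  the two values there yields a separating subbasic set.\<close>

lemma t0_space_compact_open:
  assumes "t0_space Y"
  shows "t0_space (compact_open_topology X Y)"
  unfolding t0_space_def topspace_compact_open_topology
proof (intro ballI impI)
  fix f g
  assume f: "f \<in> continuous_maps X Y" and g: "g \<in> continuous_maps X Y" and "f \<noteq> g"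
  then obtain x where x: "x \<in> topspace X" and "f x \<noteq> g x"
    by (auto simp: continuous_maps_def intro: extensionalityI)
  moreover have "f x \<in> topspace Y" "g x \<in> topspace Y"
    using f g x by (auto simp: continuous_maps_def continuous_map_def)
  ultimately obtain V where V: "openin Y V" "f x \<notin> V \<longleftrightarrow> g x \<in> V"
    using assms unfolding t0_space_def by blast
  let ?U = "compact_open_subbasic X Y {x} V"
  have "openin (compact_open_topology X Y) ?U"
    using x V by (simp add: openin_compact_open_subbasic)
  moreover have "f \<notin> ?U \<longleftrightarrow> g \<in> ?U"
    using f g V by (simp add: compact_open_subbasic_def)
  ultimately show "\<exists>U. openin (compact_open_topology X Y) U \<and> (f \<notin> U \<longleftrightarrow> g \<in> U)"
    by blast
qed

section \<open>Directed limits of maps into a d-space\<close>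

lemma d_space_compact_open:
  assumes "d_space Y"
  shows "d_space (compact_open_topology X Y)"
  unfolding d_space_iff_directed_limit
proof (intro conjI allI impI)
  show "t0_space (compact_open_topology X Y)"
    using assms by (simp add: d_space_def t0_space_compact_open)
next
  let ?C = "compact_open_topology X Y"
  fix F assume F: "directedin ?C F"
  then have FC: "F \<subseteq> continuous_maps X Y" and "F \<noteq> {}"
    by (auto simp: directedin_def)
  have "directedin Y ((\<lambda>f. f x) ` F)" if x: "x \<in> topspace X" for x
    unfolding directedin_def
  proof (intro conjI ballI)
    show "(\<lambda>f. f x) ` F \<subseteq> topspace Y"
      using FC x by (auto simp: continuous_maps_def continuous_map_def)
  next
    fix a b assume "a \<in> (\<lambda>f. f x) ` F" "b \<in> (\<lambda>f. f x) ` F"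
    then obtain f g where fg: "f \<in> F" "g \<in> F" "a = f x" "b = g x"
      by blast
    then obtain h where "h \<in> F" "specialization_le ?C f h" "specialization_le ?C g h"
      using F unfolding directedin_def by blast
    then show "\<exists>c\<in>(\<lambda>f. f x) ` F. specialization_le Y a c \<and> specialization_le Y b c"
      using fg x by (auto simp: specialization_le_compact_open)
  qed (use \<open>F \<noteq> {}\<close> in simp)
  then have "\<forall>x\<in>topspace X. \<exists>y. directed_limit Y ((\<lambda>f. f x) ` F) y"
    using assms by (simp add: d_space_iff_directed_limit)
  then obtain s0 where s0: "\<And>x. x \<in> topspace X \<Longrightarrow> directed_limit Y ((\<lambda>f. f x) ` F) (s0 x)"
    by metis
  \<comment> \<open>Restricting makes the chosen limits extensional, as
    \<open>continuous_maps\<close> demands.\<close>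
  define s where "s = restrict s0 (topspace X)"
  have s: "directed_limit Y ((\<lambda>f. f x) ` F) (s x)" if "x \<in> topspace X" for x
    using s0[OF that] that by (simp add: s_def)
  have upper: "specialization_le Y (f x) (s x)" if "f \<in> F" "x \<in> topspace X" for f x
    using s[OF that(2)] that(1) by (auto simp: directed_limit_def)
  have meets: "\<exists>f\<in>F. f x \<in> V" if "x \<in> topspace X" "openin Y V" "s x \<in> V" for x V
    using s[OF that(1)] that(2,3) unfolding directed_limit_def by blast
  have preimage: "openin X {x \<in> topspace X. f x \<in> V}" if "f \<in> F" "openin Y V" for f V
    using FC that by (auto simp: continuous_maps_def continuous_map_def)
  have "openin X {x \<in> topspace X. s x \<in> V}" if V: "openin Y V" for V
  proof -
    have "{x \<in> topspace X. s x \<in> V} = (\<Union>f\<in>F. {x \<in> topspace X. f x \<in> V})"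
      using meets[OF _ V] specialization_leD[OF upper V] by blast
    then show ?thesis
      using preimage V by auto
  qed
  moreover have "s x \<in> topspace Y" if "x \<in> topspace X" for x
    using s[OF that] by (simp add: directed_limit_def)
  ultimately have sC: "s \<in> continuous_maps X Y"
    by (auto simp: continuous_maps_def continuous_map_def s_def)
  have "s \<in> U \<longrightarrow> F \<inter> U \<noteq> {}" if "openin ?C U" for U
  proof -
    \<comment> \<open>Merely meeting \<open>F\<close> does not survive intersections, since two sets
      may be met by different maps. Containing a whole tail of \<open>F\<close> does, by
      directedness.\<close>
    have "s \<in> U \<longrightarrow> (\<exists>f\<in>F. \<forall>g\<in>F. specialization_le ?C f g \<longrightarrow> g \<in> U)"
      using that[unfolded compact_open_topology_def openin_topology_generated_by_iff]
    proof induction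
      case (Int A B)
      show ?case
      proof
        assume "s \<in> A \<inter> B"
        then obtain f g where fg: "f \<in> F" "\<forall>k\<in>F. specialization_le ?C f k \<longrightarrow> k \<in> A"
            "g \<in> F" "\<forall>k\<in>F. specialization_le ?C g k \<longrightarrow> k \<in> B"
          using Int.IH by auto
        then obtain h where "h \<in> F" "specialization_le ?C f h" "specialization_le ?C g h"
          using F unfolding directedin_def by blast
        with fg show "\<exists>h\<in>F. \<forall>k\<in>F. specialization_le ?C h k \<longrightarrow> k \<in> A \<inter> B"
          by (blast intro: specialization_le_trans)
      qed
    next
      case (Basis S)
      then obtain K V where S: "S = compact_open_subbasic X Y K V" and K: "compactin X K"
          and V: "openin Y V"
        by auto
      show ?case
      proof
        assume "s \<in> S"
        then have "K \<subseteq> (\<Union>f\<in>F. {x \<in> topspace X. f x \<in> V})"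
          using meets[OF _ V] compactin_subset_topspace[OF K]
          unfolding S compact_open_subbasic_def by blast
        then obtain \<U> where "finite \<U>" "\<U> \<subseteq> (\<lambda>f. {x \<in> topspace X. f x \<in> V}) ` F" "K \<subseteq> \<Union>\<U>"
          using compactinD[OF K, of "(\<lambda>f. {x \<in> topspace X. f x \<in> V}) ` F"] preimage V by auto
        then obtain A where A: "A \<subseteq> F" "finite A" "K \<subseteq> (\<Union>f\<in>A. {x \<in> topspace X. f x \<in> V})"
          by (auto dest: finite_subset_image)
        \<comment> \<open>The map \<open>u\<close> replaces the finite subcover: at each
          \<open>x\<close> in \<open>K\<close> some \<open>f\<close> in \<open>A\<close> has its
          value in \<open>V\<close>, and every \<open>g\<close> above \<open>u\<close> has a larger
          value there.\<close>
        then obtain u where "u \<in> F" and u: "\<forall>f\<in>A. specialization_le ?C f u"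
          using directedin_finite_upper_bound[OF F] by blast
        have "g \<in> S" if g: "g \<in> F" "specialization_le ?C u g" for g
        proof -
          have "g x \<in> V" if x: "x \<in> K" for x
          proof -
            obtain f where f: "f \<in> A" "x \<in> topspace X" "f x \<in> V"
              using A(3) x by blast
            then have "specialization_le ?C f g"
              using u g(2) by (blast intro: specialization_le_trans)
            then show ?thesis
              using f V by (auto simp: specialization_le_compact_open dest: specialization_leD)
          qed
          then show ?thesis
            using FC g(1) by (auto simp: S compact_open_subbasic_def)
        qed
        with \<open>u \<in> F\<close> show "\<exists>f\<in>F. \<forall>g\<in>F. specialization_le ?C f g \<longrightarrow> g \<in> S"
          by blast
      qed
    qed blast+
    \<comment> \<open>By reflexivity a tail contains its starting map, so \<open>U\<close> meets
      \<open>F\<close>.\<close>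
    moreover have "specialization_le ?C f f" if "f \<in> F" for f
      using that FC by (auto simp: specialization_le_iff)
    ultimately show ?thesis
      by blast
  qed
  moreover have "specialization_le ?C f s" if "f \<in> F" for f
    using that FC sC upper by (auto simp: specialization_le_compact_open)
  ultimately have "directed_limit ?C F s"
    using sC by (simp add: directed_limit_def)
  then show "\<exists>s. directed_limit ?C F s"
    by blast
qed

section \<open>Recovering limits in the target from constant maps\<close>

lemma d_space_compact_open_imp_d_space:
  assumes "t0_space Y" and "topspace X \<noteq> {}" and "d_space (compact_open_topology X Y)"
  shows "d_space Y"
  unfolding d_space_iff_directed_limit
proof (intro conjI allI impI)
  let ?C = "compact_open_topology X Y"
  let ?c = "\<lambda>y. restrict (\<lambda>_. y) (topspace X)"
  fix D assume D: "directedin Y D"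
  have c: "?c y \<in> continuous_maps X Y" if "y \<in> D" for y
    using D that by (auto simp: continuous_maps_def directedin_def)
  have "directedin ?C (?c ` D)"
    unfolding directedin_def
  proof (intro conjI ballI)
    show "?c ` D \<noteq> {}" "?c ` D \<subseteq> topspace ?C"
      using D c by (auto simp: directedin_def)
  next
    fix f g assume "f \<in> ?c ` D" "g \<in> ?c ` D"
    then obtain a b where ab: "a \<in> D" "b \<in> D" "f = ?c a" "g = ?c b"
      by blast
    then obtain z where "z \<in> D" "specialization_le Y a z" "specialization_le Y b z"
      using D unfolding directedin_def by blast
    then show "\<exists>h\<in>?c ` D. specialization_le ?C f h \<and> specialization_le ?C g h"
      using ab c by (intro bexI[of _ "?c z"]) (simp_all add: specialization_le_compact_open)
  qed
  then obtain s where s: "directed_limit ?C (?c ` D) s"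
    using assms(3) unfolding d_space_iff_directed_limit by blast
  \<comment> \<open>Over an empty carrier the function space is a single point whatever
    \<open>Y\<close> is, so a point is required to read off values.\<close>
  obtain x where x: "x \<in> topspace X"
    using assms(2) by blast
  have sC: "s \<in> continuous_maps X Y"
    using s by (simp add: directed_limit_def)
  have "D \<inter> V \<noteq> {}" if V: "openin Y V" "s x \<in> V" for V
  proof -
    have "s \<in> compact_open_subbasic X Y {x} V"
      using sC V by (simp add: compact_open_subbasic_def)
    \<comment> \<open>A constant map lies in this neighbourhood of \<open>s\<close> exactly when its
      value lies in \<open>V\<close>.\<close>
    then have "?c ` D \<inter> compact_open_subbasic X Y {x} V \<noteq> {}"
      using s x V openin_compact_open_subbasic[of X "{x}" Y V] by (simp add: directed_limit_def)
    then show ?thesis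
      using x by (auto simp: compact_open_subbasic_def)
  qed
  moreover have "specialization_le Y y (s x)" if "y \<in> D" for y
    using s x that by (auto simp: directed_limit_def specialization_le_compact_open)
  moreover have "s x \<in> topspace Y"
    using sC x by (auto simp: continuous_maps_def continuous_map_def)
  ultimately show "\<exists>y. directed_limit Y D y"
    unfolding directed_limit_def by blast
qed (fact assms(1))

theorem corollary4p17:
  fixes X :: "'a topology" and Y :: "'b topology"
  assumes "t0_space X" and "t0_space Y" and "topspace X \<noteq> {}"
  shows "d_space Y \<longleftrightarrow> d_space (compact_open_topology X Y)"
  by (rule iffI[OF d_space_compact_open d_space_compact_open_imp_d_space[OF assms(2,3)]])

end
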